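(* Let $G$ and $H$ be graphs, let $v_c \in V(G)$, and let $\widetilde{G}$ be a graph obtained from $G$ and $H$ by the $A$-cospectral construction with fixed vertex $v_c$ (defined in the context), with subgraphs $G^1, G^2, H$. Then the vertices $v_c^1$ and $v_c^2$ are $A$-cospectral in $\widetilde{G}$.
   Context: All graphs (including the constructed ones) are finite, nonempty, undirected, connected, without loops (and without multiple edges). For a graph $G$ and $v_c\in V(G)$, $\mathrm{Aut}(G,v_c)$ is the group of graph automorphisms of $G$ that fix $v_c$, and $[v_j]_{v_c}\subseteq V(G)$ is the orbit of the vertex $v_j$ under the action of $\mathrm{Aut}(G,v_c)$ on $V(G)$. $A$-cospectral construction. Take $H$ together with two copies $G^1, G^2$ of $G$ (all three vertex-disjoint). The copies of a vertex $v_j\in V(G)$ in $G^1$ and $G^2$ are denoted $v_j^1$ and $v_j^2$. Keep all edges of $G^1$, $G^2$, $H$, add no edges between $G^1$ and $G^2$, and add arbitrarily many edges between $V(G^1)$ and $V(H)$ and between $V(G^2)$ and $V(H)$ subject to the following condition: for every added edge between $v_j^1\in V(G^1)$ and $v'_\alpha\in V(H)$, a corresponding edge is added between $v'_\alpha$ and a vertex $v_m^2\in V(G^2)$ with $v_m\in[v_j]_{v_c}$, and these are all the added edges. In other words, for every $v'\in V(H)$ and every orbit $O$ of $\mathrm{Aut}(G,v_c)$ on $V(G)$, the number of neighbours of $v'$ in $\{v^1: v\in O\}$ equals the number of neighbours of $v'$ in $\{v^2: v\in O\}$. The resulting graph is $\widetilde G$. For a graph with $n$ vertices, the vertex $v$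 is associated with a standard basis vector $\boldsymbol{v}\in\mathbb{R}^n$. For a linear map (matrix) $M$ on $\mathbb{R}^n$ and $\boldsymbol{x}\in\mathbb{R}^n$, $\langle\boldsymbol{x}\rangle_M=\mathrm{span}\{\boldsymbol{x},M\boldsymbol{x},M^2\boldsymbol{x},\dots\}$. Two distinct vertices $v_i,v_j$ of a graph with adjacency matrix $A$ are $A$-cospectral if the subspaces $\langle\boldsymbol{v}_i+\boldsymbol{v}_j\rangle_A$ and $\langle\boldsymbol{v}_i-\boldsymbol{v}_j\rangle_A$ are orthogonal. *)

theory Defs
  imports
    "Graph_Theory.Digraph_Component"
    "HOL-Combinatorics.Permutations"
    "HOL-Analysis.Analysis"
begin

text \<open>
  A graph is a symmetric loopfree finite digraph on vertex pairs (locale \<^locale>\<open>pair_graph\<close>),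
  so it has no multiple edges by construction. Its vertex set is a whole finite type
  \<open>'v\<close>, so that \<open>\<real>\<^sup>n\<close> with \<open>n = |V|\<close> and its standard basis indexed by the vertices is
  \<open>real ^ 'v\<close> with the vectors \<open>axis v 1\<close>; types are nonempty, hence so are the graphs.
  The constant \<open>connected\<close> of the graph library is qualified because the
  topological notion of the same name shadows it.
\<close>

definition connected_graph :: "'v::finite pair_pre_digraph \<Rightarrow> bool" where
  "connected_graph G \<longleftrightarrow>
     pair_graph G \<and> pverts G = UNIV \<and> Digraph_Component.connected (with_proj G)"

definition Aut_fix :: "'v pair_pre_digraph \<Rightarrow> 'v \<Rightarrow> ('v \<Rightarrow> 'v) set" where
  "Aut_fix G c =
     {f. f permutes pverts G \<and>
         (\<forall>u\<in>pverts G. \<forall>v\<in>pverts G. (f u, f v) \<in> parcs G \<longleftrightarrow> (u, v) \<in> parcs G) \<and>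
         f c = c}"

definition Aut_orbit :: "'v pair_pre_digraph \<Rightarrow> 'v \<Rightarrow> 'v \<Rightarrow> 'v set" where
  "Aut_orbit G c v = {f v | f. f \<in> Aut_fix G c}"

text \<open>
  The disjoint union of \<open>V(G\<^sup>1)\<close>, \<open>V(G\<^sup>2)\<close> and \<open>V(H)\<close> is a sum type.
\<close>

abbreviation copy1 :: "'g \<Rightarrow> 'g + 'g + 'h" where
  "copy1 v \<equiv> Inl v"

abbreviation copy2 :: "'g \<Rightarrow> 'g + 'g + 'h" where
  "copy2 v \<equiv> Inr (Inl v)"

abbreviation inH :: "'h \<Rightarrow> 'g + 'g + 'h" where
  "inH w \<equiv> Inr (Inr w)"

text \<open>
  \<open>A_construction G H c K\<close>: the graph \<open>K\<close> arises from \<open>G\<close> and \<open>H\<close> by the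
  \<open>A\<close>-cospectral construction with fixed vertex \<open>c\<close>. Edges between a copy of \<open>G\<close> and \<open>H\<close>
  are unrestricted except for the last conjunct, in which \<open>Aut_orbit G c u\<close> runs through
  all orbits. Only one orientation of these edges is mentioned, as graphs are symmetric.
\<close>

definition A_construction ::
  "'g pair_pre_digraph \<Rightarrow> 'h pair_pre_digraph \<Rightarrow> 'g \<Rightarrow> ('g + 'g + 'h) pair_pre_digraph \<Rightarrow> bool"
where
  "A_construction G H c K \<longleftrightarrow>
     pverts K = copy1 ` pverts G \<union> copy2 ` pverts G \<union> inH ` pverts H \<and>
     (\<forall>u\<in>pverts G. \<forall>v\<in>pverts G. (copy1 u, copy1 v) \<in> parcs K \<longleftrightarrow> (u, v) \<in> parcs G) \<and>
     (\<forall>u\<in>pverts G. \<forall>v\<in>pverts G. (copy2 u, copy2 v) \<in> parcs K \<longleftrightarrow> (u, v) \<in> parcs G) \<and>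
     (\<forall>u\<in>pverts H. \<forall>v\<in>pverts H. (inH u, inH v) \<in> parcs K \<longleftrightarrow> (u, v) \<in> parcs H) \<and>
     (\<forall>u\<in>pverts G. \<forall>v\<in>pverts G. (copy1 u, copy2 v) \<notin> parcs K \<and> (copy2 v, copy1 u) \<notin> parcs K) \<and>
     (\<forall>w\<in>pverts H. \<forall>u\<in>pverts G.
        card {v \<in> Aut_orbit G c u. (inH w, copy1 v) \<in> parcs K} =
        card {v \<in> Aut_orbit G c u. (inH w, copy2 v) \<in> parcs K})"

definition adjacency_matrix :: "'v::finite pair_pre_digraph \<Rightarrow> real ^ 'v ^ 'v" where
  "adjacency_matrix G = (\<chi> u v. if (u, v) \<in> parcs G then 1 else 0)"

definition cyclic_subspace :: "real ^ 'v ^ 'v \<Rightarrow> real ^ 'v \<Rightarrow> (real ^ 'v::finite) set" where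
  "cyclic_subspace M x = span (range (\<lambda>k::nat. (((*v) M) ^^ k) x))"

definition A_cospectral :: "'v::finite pair_pre_digraph \<Rightarrow> 'v \<Rightarrow> 'v \<Rightarrow> bool" where
  "A_cospectral G i j \<longleftrightarrow>
     i \<noteq> j \<and>
     (\<forall>x \<in> cyclic_subspace (adjacency_matrix G) (axis i 1 + axis j 1).
      \<forall>y \<in> cyclic_subspace (adjacency_matrix G) (axis i 1 - axis j 1).
        orthogonal x y)"

end

theory Submission
  imports Defs
begin

text \<open>
  Write \<open>A\<close> for the adjacency matrix of \<open>K\<close>. Consider the space \<open>W\<close> of all vectors that vanish
  on \<open>H\<close>, take opposite values on the two copies of each vertex of \<open>G\<close>, and are constant on each
  copy of every orbit of \<open>Aut(G, c)\<close> (\<open>skew_orbit_vectors\<close>).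

  The space \<open>W\<close> is invariant under \<open>A\<close> (\<open>adjacency_matrix_skew_orbit_vectors\<close>). On the two copies
  of \<open>G\<close> the matrix acts on \<open>W\<close> like the adjacency matrix of \<open>G\<close>, which commutes with the
  automorphisms of \<open>G\<close>. At a vertex \<open>w\<close> of \<open>H\<close> the value of \<open>A y\<close> is the sum of \<open>y\<close> over the
  neighbours of \<open>w\<close> in the two copies; since \<open>w\<close> has equally many neighbours in the two copies of
  each orbit, and \<open>y\<close> is constant with opposite signs there, everything cancels
  (\<open>sum_orbit_invariant_eq\<close>).

  As \<open>c\<close> is fixed, its orbit is a singleton, so the difference of the two basis vectors at the
  copies of \<open>c\<close> lies in \<open>W\<close>, and with it the cyclic subspace that it generates. The sum of the two
  basis vectors is orthogonal to \<open>W\<close>. Because \<open>A\<close> is symmetric, the orthogonal complement of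
  \<open>W\<close> is invariant under \<open>A\<close> as well, so it contains the other cyclic subspace.
\<close>

lemma Aut_fix_id: "id \<in> Aut_fix G c"
  by (simp add: Aut_fix_def permutes_id)

lemma Aut_fix_comp:
  assumes "f \<in> Aut_fix G c" and "g \<in> Aut_fix G c"
  shows "f \<circ> g \<in> Aut_fix G c"
  using assms by (auto simp: Aut_fix_def permutes_compose permutes_in_image)

lemma Aut_fix_inv:
  assumes "f \<in> Aut_fix G c"
  shows "inv f \<in> Aut_fix G c"
proof -
  have f: "f permutes pverts G" and fc: "f c = c"
    and arcs: "\<And>u v. u \<in> pverts G \<Longrightarrow> v \<in> pverts G \<Longrightarrow>
      (f u, f v) \<in> parcs G \<longleftrightarrow> (u, v) \<in> parcs G"
    using assms by (auto simp: Aut_fix_def)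
  have inv: "inv f permutes pverts G"
    using f by (rule permutes_inv)
  have "(inv f u, inv f v) \<in> parcs G \<longleftrightarrow> (u, v) \<in> parcs G"
    if "u \<in> pverts G" "v \<in> pverts G" for u v
    using arcs[of "inv f u" "inv f v"] that inv f
    by (simp add: permutes_in_image permutes_inverses)
  moreover have "inv f c = c"
    using f fc by (metis permutes_inverses(2))
  ultimately show ?thesis
    using inv by (simp add: Aut_fix_def)
qed

lemma Aut_orbit_eq_iff: "Aut_orbit G c u = Aut_orbit G c v \<longleftrightarrow> u \<in> Aut_orbit G c v"
proof
  assume "Aut_orbit G c u = Aut_orbit G c v"
  moreover have "u \<in> Aut_orbit G c u"
    by (auto simp: Aut_orbit_def intro!: exI[of _ id] Aut_fix_id)
  ultimately show "u \<in> Aut_orbit G c v" by simp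
next
  assume "u \<in> Aut_orbit G c v"
  then obtain f where f: "f \<in> Aut_fix G c" and u: "u = f v"
    by (auto simp: Aut_orbit_def)
  have bij: "f permutes pverts G"
    using f by (simp add: Aut_fix_def)
  have "g u \<in> Aut_orbit G c v" if "g \<in> Aut_fix G c" for g
    using Aut_fix_comp[OF that f] u by (auto simp: Aut_orbit_def intro!: exI[of _ "g \<circ> f"])
  moreover have "g v \<in> Aut_orbit G c u" if "g \<in> Aut_fix G c" for g
  proof -
    have "g v = (g \<circ> inv f) u"
      using u permutes_inverses(2)[OF bij] by simp
    then show ?thesis
      using Aut_fix_comp[OF that Aut_fix_inv[OF f]] unfolding Aut_orbit_def by blast
  qed
  ultimately show "Aut_orbit G c u = Aut_orbit G c v"
    by (auto simp: Aut_orbit_def[of G c u] Aut_orbit_def[of G c v])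
qed

text \<open>
  The orbits partition the vertex set, and on each orbit both sums count the selected vertices,
  weighted by the common value of \<open>g\<close>.
\<close>

lemma sum_orbit_invariant_eq:
  fixes g :: "'v \<Rightarrow> real"
  assumes fin: "finite (pverts G)"
    and inv: "\<And>f v. f \<in> Aut_fix G c \<Longrightarrow> v \<in> pverts G \<Longrightarrow> g (f v) = g v"
    and card: "\<And>u. u \<in> pverts G \<Longrightarrow>
      card {v \<in> Aut_orbit G c u. P v} = card {v \<in> Aut_orbit G c u. Q v}"
  shows "(\<Sum>v\<in>pverts G. of_bool (P v) * g v) = (\<Sum>v\<in>pverts G. of_bool (Q v) * g v)"
proof -
  let ?V = "pverts G" and ?O = "Aut_orbit G c"
  have sub: "?O u \<subseteq> ?V" if "u \<in> ?V" for u
    using that by (auto simp: Aut_orbit_def Aut_fix_def permutes_in_image)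
  have by_orbits: "(\<Sum>v\<in>?V. of_bool (R v) * g v) =
      (\<Sum>B\<in>?O ` ?V. \<Sum>v\<in>{v \<in> ?V. ?O v = B}. of_bool (R v) * g v)" for R
    using fin by (subst sum.group) auto
  have on_orbit: "(\<Sum>v\<in>{v \<in> ?V. ?O v = ?O u}. of_bool (R v) * g v) =
      card {v \<in> ?O u. R v} * g u" if u: "u \<in> ?V" for R u
  proof -
    have eq: "{v \<in> ?V. ?O v = ?O u} = ?O u"
      using sub[OF u] by (auto simp: Aut_orbit_eq_iff)
    have fin_u: "finite (?O u)"
      using sub[OF u] fin by (rule finite_subset)
    have "(\<Sum>v\<in>?O u. of_bool (R v) * g v) = (\<Sum>v\<in>?O u. of_bool (R v) * g u)"
      using inv u by (intro sum.cong) (auto simp: Aut_orbit_def)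
    also have "\<dots> = card {v \<in> ?O u. R v} * g u"
      using fin_u by (simp add: sum_distrib_right[symmetric] of_bool_def sum.If_cases Int_def)
    finally show ?thesis by (simp add: eq)
  qed
  show ?thesis
    unfolding by_orbits
  proof (rule sum.cong[OF refl])
    fix B
    assume "B \<in> ?O ` ?V"
    then obtain u where "u \<in> ?V" and "B = ?O u" by blast
    then show "(\<Sum>v\<in>{v \<in> ?V. ?O v = B}. of_bool (P v) * g v) =
        (\<Sum>v\<in>{v \<in> ?V. ?O v = B}. of_bool (Q v) * g v)"
      using on_orbit[of u P] on_orbit[of u Q] card[of u] by simp
  qed
qed

definition skew_orbit_vectors ::
  "'g::finite pair_pre_digraph \<Rightarrow> 'g \<Rightarrow> (real ^ ('g + 'g + 'h::finite)) set" where
  "skew_orbit_vectors G c =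
     {y. (\<forall>w. y $ inH w = 0) \<and>
         (\<forall>v. y $ copy2 v = - y $ copy1 v) \<and>
         (\<forall>f\<in>Aut_fix G c. \<forall>v. y $ copy1 (f v) = y $ copy1 v)}"

lemma subspace_skew_orbit_vectors: "subspace (skew_orbit_vectors G c)"
  by (auto simp: subspace_def skew_orbit_vectors_def)

text \<open>An automorphism fixing \<open>c\<close> moves no other vertex to \<open>c\<close>.\<close>

lemma axis_diff_in_skew_orbit_vectors:
  "axis (copy1 c) 1 - axis (copy2 c) 1 \<in> skew_orbit_vectors G c"
proof -
  have "f v = c \<longleftrightarrow> v = c" if "f \<in> Aut_fix G c" for f v
    using that permutes_inj[of f "pverts G"] by (auto simp: Aut_fix_def dest: injD)
  then show ?thesis
    by (auto simp: skew_orbit_vectors_def axis_def)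
qed

lemma axis_sum_orthogonal_skew_orbit_vectors:
  assumes "y \<in> skew_orbit_vectors G c"
  shows "(axis (copy1 c) 1 + axis (copy2 c) 1) \<bullet> y = 0"
  using assms by (simp add: skew_orbit_vectors_def inner_add_left inner_axis')

lemma adjacency_matrix_vector_nth:
  "(adjacency_matrix K *v y) $ p = (\<Sum>q\<in>UNIV. of_bool ((p, q) \<in> parcs K) * y $ q)"
  by (simp add: adjacency_matrix_def matrix_vector_mult_def of_bool_def)

lemma sum_over_copies:
  fixes h :: "'g::finite + 'g + 'h::finite \<Rightarrow> real"
  shows "(\<Sum>q\<in>UNIV. h q) =
    (\<Sum>v\<in>UNIV. h (copy1 v)) + (\<Sum>v\<in>UNIV. h (copy2 v)) + (\<Sum>w\<in>UNIV. h (inH w))"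
  by (simp add: UNIV_Plus_UNIV[symmetric] sum.Plus o_def add.assoc del: UNIV_Plus_UNIV)

lemma adjacency_matrix_skew_orbit_vectors:
  fixes G :: "'g::finite pair_pre_digraph" and H :: "'h::finite pair_pre_digraph"
  assumes G: "pverts G = UNIV" and H: "pverts H = UNIV"
    and K: "A_construction G H c K"
    and y: "y \<in> skew_orbit_vectors G c"
  shows "adjacency_matrix K *v y \<in> skew_orbit_vectors G c"
proof -
  let ?g = "\<lambda>v. y $ copy1 v"
  have y_H: "\<And>w. y $ inH w = 0" and y_2: "\<And>v. y $ copy2 v = - ?g v"
    and y_inv: "\<And>f v. f \<in> Aut_fix G c \<Longrightarrow> ?g (f v) = ?g v"
    using y by (auto simp: skew_orbit_vectors_def)
  have arcs:
    "\<And>u v. (copy1 u, copy1 v) \<in> parcs K \<longleftrightarrow> (u, v) \<in> parcs G"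
    "\<And>u v. (copy2 u, copy2 v) \<in> parcs K \<longleftrightarrow> (u, v) \<in> parcs G"
    "\<And>u v. (copy1 u, copy2 v) \<notin> parcs K"
    "\<And>u v. (copy2 u, copy1 v) \<notin> parcs K"
    and balanced: "\<And>w u. card {v \<in> Aut_orbit G c u. (inH w, copy1 v) \<in> parcs K} =
      card {v \<in> Aut_orbit G c u. (inH w, copy2 v) \<in> parcs K}"
    using K G H by (auto simp: A_construction_def)
  have at_1: "(adjacency_matrix K *v y) $ copy1 v =
      (\<Sum>u\<in>UNIV. of_bool ((v, u) \<in> parcs G) * ?g u)" for v
    by (simp add: adjacency_matrix_vector_nth sum_over_copies arcs y_H)
  have at_2: "(adjacency_matrix K *v y) $ copy2 v =
      - (\<Sum>u\<in>UNIV. of_bool ((v, u) \<in> parcs G) * ?g u)" for v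
    by (simp add: adjacency_matrix_vector_nth sum_over_copies arcs y_H y_2 sum_negf)
  have at_H: "(adjacency_matrix K *v y) $ inH w = 0" for w
    using sum_orbit_invariant_eq[where G = G and c = c and g = ?g
        and P = "\<lambda>v. (inH w, copy1 v) \<in> parcs K" and Q = "\<lambda>v. (inH w, copy2 v) \<in> parcs K"]
      y_inv balanced
    by (simp add: adjacency_matrix_vector_nth sum_over_copies y_H y_2 sum_negf G)
  have "(\<Sum>u\<in>UNIV. of_bool ((f v, u) \<in> parcs G) * ?g u) =
      (\<Sum>u\<in>UNIV. of_bool ((v, u) \<in> parcs G) * ?g u)" if f: "f \<in> Aut_fix G c" for f v
  proof -
    have perm: "f permutes UNIV" and aut: "\<And>u. (f v, f u) \<in> parcs G \<longleftrightarrow> (v, u) \<in> parcs G"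
      using f G by (auto simp: Aut_fix_def)
    have "(\<Sum>u\<in>UNIV. of_bool ((f v, u) \<in> parcs G) * ?g u) =
        (\<Sum>u\<in>UNIV. of_bool ((f v, f u) \<in> parcs G) * ?g (f u))"
      by (subst sum.permute[OF perm]) (simp add: o_def)
    then show ?thesis
      by (simp add: aut y_inv[OF f])
  qed
  then show ?thesis
    by (simp add: skew_orbit_vectors_def at_1 at_2 at_H)
qed

lemma cyclic_subspace_subset:
  assumes "subspace W" and "x \<in> W" and "\<And>z. z \<in> W \<Longrightarrow> M *v z \<in> W"
  shows "cyclic_subspace M x \<subseteq> W"
proof -
  have "(((*v) M) ^^ k) x \<in> W" for k
    by (induction k) (use assms in auto)
  then show ?thesis
    unfolding cyclic_subspace_def using assms(1) by (intro span_minimal) auto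
qed

text \<open>The orthogonal complement of an invariant set of a symmetric matrix is invariant.\<close>

lemma cyclic_subspaces_orthogonal:
  fixes M :: "real ^ 'v::finite ^ 'v"
  assumes sym: "transpose M = M"
    and W: "subspace W" "\<And>z. z \<in> W \<Longrightarrow> M *v z \<in> W"
    and a: "\<And>z. z \<in> W \<Longrightarrow> a \<bullet> z = 0" and b: "b \<in> W"
    and x: "x \<in> cyclic_subspace M a" and y: "y \<in> cyclic_subspace M b"
  shows "orthogonal x y"
proof -
  let ?P = "{x. \<forall>z\<in>W. x \<bullet> z = 0}"
  have "(M *v x) \<bullet> z = x \<bullet> (M *v z)" for x z
    by (metis dot_lmul_matrix sym transpose_matrix_vector)
  then have "M *v x \<in> ?P" if "x \<in> ?P" for x
    using that W(2) by simp
  moreover have "subspace ?P"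
    by (auto simp: subspace_def inner_add_left)
  ultimately have "cyclic_subspace M a \<subseteq> ?P"
    using a by (intro cyclic_subspace_subset) auto
  moreover have "cyclic_subspace M b \<subseteq> W"
    using W b by (intro cyclic_subspace_subset) auto
  ultimately show ?thesis
    using x y by (auto simp: orthogonal_def)
qed

lemma transpose_adjacency_matrix:
  assumes "pair_graph K"
  shows "transpose (adjacency_matrix K) = adjacency_matrix K"
proof -
  interpret pair_graph K by (fact assms)
  have "(u, v) \<in> parcs K \<longleftrightarrow> (v, u) \<in> parcs K" for u v
    using arcs_symmetric by blast
  then show ?thesis
    by (simp add: transpose_def adjacency_matrix_def vec_eq_iff)
qed

theorem theorem3p1:
  fixes G :: "'g::finite pair_pre_digraph"
    and H :: "'h::finite pair_pre_digraph"
    and K :: "('g + 'g + 'h) pair_pre_digraph"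
    and c :: 'g
  assumes "connected_graph G"
    and "connected_graph H"
    and "connected_graph K"
    and "c \<in> pverts G"
    and "A_construction G H c K"
  shows "A_cospectral K (copy1 c) (copy2 c)"
proof -
  have G: "pverts G = UNIV" and H: "pverts H = UNIV" and K: "pair_graph K"
    using assms(1-3) by (auto simp: connected_graph_def)
  have "orthogonal x y"
    if "x \<in> cyclic_subspace (adjacency_matrix K) (axis (copy1 c) 1 + axis (copy2 c) 1)"
      and "y \<in> cyclic_subspace (adjacency_matrix K) (axis (copy1 c) 1 - axis (copy2 c) 1)"
    for x y
    using transpose_adjacency_matrix[OF K] subspace_skew_orbit_vectors
      adjacency_matrix_skew_orbit_vectors[OF G H assms(5)]
      axis_sum_orthogonal_skew_orbit_vectors axis_diff_in_skew_orbit_vectors that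
    by (rule cyclic_subspaces_orthogonal)
  then show ?thesis
    by (simp add: A_cospectral_def)
qed

end
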